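(* Let $n>1$ and consider a zip tree with $n$ nodes whose ranks are independent random variables, each geometric with mean $1$ (rank $k\in\{0,1,2,\dots\}$ with probability $1/2^{k+1}$). Then the expected rank of the root is at most $\lg n+3$. Moreover, for any $c>0$, the root rank is at most $(c+1)\lg n$ with probability at least $1-1/n^c$.
   Context: A zip tree is a binary search tree (distinct keys in symmetric order: left-subtree keys smaller, right-subtree keys larger) in which each node has a numeric rank and the parent of a node has rank strictly greater than that of its left child and greater than or equal to that of its right child. $\lg$ denotes the base-$2$ logarithm. *)

theory Defs
  imports "HOL-Probability.Probability" "HOL-Library.Tree"
begin

text \<open>A tree stores the keys of its nodes. Since the keys are distinct, a node is identified with
  its key, and the numeric ranks of the nodes are given by a function \<open>rk\<close> on keys.\<close>

definition root_rank :: "('a \<Rightarrow> 'b) \<Rightarrow> 'a tree \<Rightarrow> 'b" where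
  "root_rank rk t = rk (tree.value t)" \<comment> \<open>meaningful for nonempty trees only\<close>

fun rank_ordered :: "('a \<Rightarrow> 'b::linorder) \<Rightarrow> 'a tree \<Rightarrow> bool" where
  "rank_ordered rk Leaf \<longleftrightarrow> True"
| "rank_ordered rk (Node l a r) \<longleftrightarrow>
     (l \<noteq> Leaf \<longrightarrow> root_rank rk l < rk a) \<and> (r \<noteq> Leaf \<longrightarrow> root_rank rk r \<le> rk a) \<and>
     rank_ordered rk l \<and> rank_ordered rk r"

text \<open>The predicate \<^const>\<open>bst\<close> uses the strict order on both sides, so keys are distinct.\<close>

definition zip_tree :: "('a::linorder \<Rightarrow> 'b::linorder) \<Rightarrow> 'a tree \<Rightarrow> bool" where
  "zip_tree rk t \<longleftrightarrow> bst t \<and> rank_ordered rk t"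

end

theory Submission
  imports Defs
begin

text \<open>The root carries the maximal rank. A single rank is at least \<open>k\<close> with probability
  \<open>1/2^k\<close>, so a union bound yields the tail estimate. For the expectation, with
  \<open>m = \<lceil>lg n\<rceil>\<close> the maximum is at most \<open>m\<close> plus the sum over all keys of the excess of the
  rank over \<open>m\<close>; each excess has mean \<open>1/2^m\<close>, at most \<open>1/n\<close>.\<close>

lemma rank_ordered_le_root_rank:
  "rank_ordered rk t \<Longrightarrow> x \<in> set_tree t \<Longrightarrow> rk x \<le> root_rank rk t"
proof (induction t)
  case (Node l a r)
  then show ?case
    by (cases "l = Leaf"; cases "r = Leaf") (auto simp: root_rank_def)
qed simp

lemma root_rank_eq_Max:
  assumes "rank_ordered rk t" "t \<noteq> Leaf"
  shows "root_rank rk t = Max (rk ` set_tree t)"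
proof -
  have "tree.value t \<in> set_tree t"
    using assms(2) by (cases t) auto
  then show ?thesis
    using rank_ordered_le_root_rank[OF assms(1)]
    by (intro Max_eqI[symmetric]) (auto simp: root_rank_def)
qed

text \<open>Condition on the first Bernoulli trial: success yields the value 0, failure costs one
  step and restarts the same experiment.\<close>

lemma nn_integral_geometric_pmf_unfold:
  assumes "p \<in> {0<..1}"
  shows "(\<integral>\<^sup>+k. f k \<partial>geometric_pmf p) = f 0 * p + (\<integral>\<^sup>+k. f (Suc k) \<partial>geometric_pmf p) * (1 - p)"
  using assms by (subst geometric_bind_pmf_unfold) simp_all

text \<open>Memorylessness: unfolding \<open>m\<close> trials, each success term vanishes because
  \<open>f\<close> is zero there, and each failure contributes a factor \<open>1 - p\<close>. Stated
  for a general \<open>f\<close>, it serves both the tail (indicator of \<open>{m..}\<close>) and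
  the mean excess over \<open>m\<close>.\<close>

lemma nn_integral_geometric_pmf_shift:
  fixes f :: "nat \<Rightarrow> ennreal"
  assumes p: "p \<in> {0<..1}" and f: "\<And>k. k < m \<Longrightarrow> f k = 0"
  shows "(\<integral>\<^sup>+k. f k \<partial>geometric_pmf p) = (\<integral>\<^sup>+k. f (k + m) \<partial>geometric_pmf p) * ennreal ((1 - p) ^ m)"
  using f
proof (induction m arbitrary: f)
  case (Suc m)
  have "(\<integral>\<^sup>+k. f k \<partial>geometric_pmf p) = (\<integral>\<^sup>+k. f (Suc k) \<partial>geometric_pmf p) * (1 - p)"
    using Suc.prems by (subst nn_integral_geometric_pmf_unfold[OF p]) simp
  also have "(\<integral>\<^sup>+k. f (Suc k) \<partial>geometric_pmf p)
      = (\<integral>\<^sup>+k. f (Suc (k + m)) \<partial>geometric_pmf p) * ennreal ((1 - p) ^ m)"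
    using Suc.prems by (intro Suc.IH) auto
  finally show ?case
    using p by (simp add: ac_simps ennreal_mult)
qed simp

lemma prob_geometric_pmf_atLeast:
  assumes "p \<in> {0<..1}"
  shows "measure_pmf.prob (geometric_pmf p) {m..} = (1 - p) ^ m"
proof -
  have "emeasure (geometric_pmf p) {m..} = (\<integral>\<^sup>+k. indicator {m..} k \<partial>geometric_pmf p)"
    by simp
  also have "\<dots> = ennreal ((1 - p) ^ m)"
    by (subst nn_integral_geometric_pmf_shift[OF assms, where m = m]) auto
  finally show ?thesis
    using assms by (simp add: measure_def)
qed

text \<open>Subtraction on \<open>nat\<close> truncates, so \<open>k - m\<close> is zero below
  \<open>m\<close> and the shift turns it into \<open>k\<close> itself. What remains is the known
  mean \<open>(1 - p) / p\<close>, scaled by the probability of reaching \<open>m\<close>.\<close>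

lemma
  assumes p: "p \<in> {0<..1}"
  shows integrable_geometric_pmf_excess: "integrable (geometric_pmf p) (\<lambda>k. real (k - m))"
    and expectation_geometric_pmf_excess:
      "measure_pmf.expectation (geometric_pmf p) (\<lambda>k. real (k - m)) = (1 - p) ^ m * ((1 - p) / p)"
proof -
  show int: "integrable (geometric_pmf p) (\<lambda>k. real (k - m))"
    by (rule Bochner_Integration.integrable_bound[OF integrable_real_geometric_pmf[OF p]]) auto
  have "(\<integral>\<^sup>+k. real (k - m) \<partial>geometric_pmf p)
      = (\<integral>\<^sup>+k. real k \<partial>geometric_pmf p) * ennreal ((1 - p) ^ m)"
    by (subst nn_integral_geometric_pmf_shift[OF p, where m = m]) auto
  also have "(\<integral>\<^sup>+k. real k \<partial>geometric_pmf p) = ennreal ((1 - p) / p)"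
    using integrable_real_geometric_pmf[OF p]
    by (subst nn_integral_eq_integral) (auto simp: expectation_geometric_pmf[OF p])
  finally show "measure_pmf.expectation (geometric_pmf p) (\<lambda>k. real (k - m))
      = (1 - p) ^ m * ((1 - p) / p)"
    using p by (subst integral_eq_nn_integral) (auto simp: mult.commute simp flip: ennreal_mult)
qed

theorem theorem2:
  fixes M :: "'w measure" and K :: "'a::linorder set" and n :: nat
    and R :: "'a \<Rightarrow> 'w \<Rightarrow> nat" and T :: "'w \<Rightarrow> 'a tree"
  assumes "prob_space M"
    and "finite K" and "card K = n" and "n > 1"
    and "prob_space.indep_vars M (\<lambda>_. count_space UNIV) R K"
    and "\<And>x. x \<in> K \<Longrightarrow>
           distr M (count_space UNIV) (R x) = measure_pmf (geometric_pmf (1/2))"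
    and "\<And>\<omega>. \<omega> \<in> space M \<Longrightarrow> zip_tree (\<lambda>x. R x \<omega>) (T \<omega>) \<and> set_tree (T \<omega>) = K"
  shows "integrable M (\<lambda>\<omega>. real (root_rank (\<lambda>x. R x \<omega>) (T \<omega>)))
     \<and> prob_space.expectation M (\<lambda>\<omega>. real (root_rank (\<lambda>x. R x \<omega>) (T \<omega>))) \<le> log 2 (real n) + 3
     \<and> (\<forall>c::real. c > 0 \<longrightarrow>
          prob_space.prob M {\<omega> \<in> space M.
             real (root_rank (\<lambda>x. R x \<omega>) (T \<omega>)) \<le> (c + 1) * log 2 (real n)}
          \<ge> 1 - 1 / real n powr c)"
proof -
  interpret prob_space M by fact
  define Y where "Y \<omega> = root_rank (\<lambda>x. R x \<omega>) (T \<omega>)" for \<omega>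
  have "K \<noteq> {}"
    using assms(3,4) by auto
  have R[measurable]: "R x \<in> measurable M (count_space UNIV)" if "x \<in> K" for x
    using assms(5) that by (auto simp: indep_vars_def)
  have Y: "Y \<omega> = Max ((\<lambda>x. R x \<omega>) ` K)" if "\<omega> \<in> space M" for \<omega>
  proof -
    \<comment> \<open>\<open>root_rank\<close> says something about the ranks only for a nonempty
      tree.\<close>
    have "T \<omega> \<noteq> Leaf"
      using assms(7)[OF that] \<open>K \<noteq> {}\<close> by auto
    then show ?thesis
      using root_rank_eq_Max[of "\<lambda>x. R x \<omega>" "T \<omega>"] assms(7)[OF that]
      by (simp add: Y_def zip_tree_def)
  qed
  have Y_ge_iff: "k \<le> Y \<omega> \<longleftrightarrow> (\<exists>x\<in>K. k \<le> R x \<omega>)" if "\<omega> \<in> space M" for \<omega> k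
    using assms(2) \<open>K \<noteq> {}\<close> by (simp add: Y[OF that] Max_ge_iff)
  \<comment> \<open>Nothing is assumed about measurability of \<open>T\<close>, so it is derived
    from the form of \<open>Y\<close> as a finite maximum of the measurable \<open>R x\<close>. On
    \<open>nat\<close> the Borel sets are all sets, which links the two target spaces.\<close>
  have Ymeas[measurable]: "Y \<in> measurable M (count_space UNIV)"
  proof -
    have cong: "measurable M borel = measurable M (count_space (UNIV :: nat set))"
      by (intro measurable_cong_sets sets_borel_eq_count_space refl)
    have "(\<lambda>\<omega>. Max ((\<lambda>x. R x \<omega>) ` K)) \<in> borel_measurable M"
      using assms(2) R by (intro borel_measurable_Max) (simp_all add: cong)
    then show ?thesis
      by (subst measurable_cong[OF Y]) (simp_all add: cong)
  qed
  have half: "(1/2 :: real) \<in> {0<..1}"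
    by simp

  have tail: "prob {\<omega> \<in> space M. k \<le> Y \<omega>} \<le> n / 2 ^ k" for k
  proof -
    have single: "prob {\<omega> \<in> space M. k \<le> R x \<omega>} = 1 / 2 ^ k" if "x \<in> K" for x
    proof -
      have "prob {\<omega> \<in> space M. k \<le> R x \<omega>} = measure (distr M (count_space UNIV) (R x)) {k..}"
        using R[OF that] by (subst measure_distr) (auto intro: arg_cong[where f = prob])
      then show ?thesis
        by (simp add: assms(6)[OF that] prob_geometric_pmf_atLeast[OF half] power_one_over)
    qed
    have "{\<omega> \<in> space M. k \<le> Y \<omega>} = (\<Union>x\<in>K. {\<omega> \<in> space M. k \<le> R x \<omega>})"
      using Y_ge_iff by auto
    then have "prob {\<omega> \<in> space M. k \<le> Y \<omega>} \<le> (\<Sum>x\<in>K. prob {\<omega> \<in> space M. k \<le> R x \<omega>})"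
      using assms(2) by (simp del: measure_UNION) (intro finite_measure_subadditive_finite, auto)
    also have "\<dots> = n / 2 ^ k"
      by (simp add: single assms(3))
    finally show ?thesis .
  qed

  \<comment> \<open>Rounding up gives \<open>n \<le> 2 ^ m\<close>, so the \<open>n\<close> mean
    excesses sum to at most 1, while \<open>m\<close> exceeds \<open>log 2 n\<close> by at most 1.
    Together this even gives \<open>log 2 n + 2\<close>.\<close>
  define m where "m = nat \<lceil>log 2 n\<rceil>"
  have m: "log 2 n \<le> m" "m \<le> log 2 n + 1"
    using assms(4) unfolding m_def by (auto simp: le_nat_iff intro: of_int_ceiling_le_add_one)
  have n_le: "n \<le> (2::real) ^ m"
    using m(1) assms(4) by (simp add: log_le_iff powr_realpow)
  define Z where "Z \<omega> = real m + (\<Sum>x\<in>K. real (R x \<omega> - m))" for \<omega>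
  have excess: "integrable M (\<lambda>\<omega>. real (R x \<omega> - m))"
      "expectation (\<lambda>\<omega>. real (R x \<omega> - m)) = 1 / 2 ^ m" if "x \<in> K" for x
  proof -
    have "integrable (distr M (count_space UNIV) (R x)) (\<lambda>k. real (k - m))"
      unfolding assms(6)[OF that] by (rule integrable_geometric_pmf_excess[OF half])
    then show "integrable M (\<lambda>\<omega>. real (R x \<omega> - m))"
      using R[OF that] by (subst (asm) integrable_distr_eq) auto
    have "expectation (\<lambda>\<omega>. real (R x \<omega> - m))
        = (\<integral>k. real (k - m) \<partial>distr M (count_space UNIV) (R x))"
      using R[OF that] by (subst integral_distr) auto
    also have "\<dots> = 1 / 2 ^ m"
      unfolding assms(6)[OF that]
      by (subst expectation_geometric_pmf_excess[OF half]) (simp add: power_one_over)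
    finally show "expectation (\<lambda>\<omega>. real (R x \<omega> - m)) = 1 / 2 ^ m" .
  qed
  have Z_int: "integrable M Z"
    unfolding Z_def using excess by auto
  \<comment> \<open>At a key of maximal rank,
    \<open>R x \<omega> \<le> m + (R x \<omega> - m)\<close> holds even when the difference
    truncates to 0; the other summands are nonnegative.\<close>
  have Y_le_Z: "real (Y \<omega>) \<le> Z \<omega>" if "\<omega> \<in> space M" for \<omega>
  proof -
    obtain x where x: "x \<in> K" "Y \<omega> \<le> R x \<omega>"
      using Y_ge_iff[OF \<open>\<omega> \<in> space M\<close>, of "Y \<omega>"] by auto
    have "real (R x \<omega> - m) \<le> (\<Sum>x\<in>K. real (R x \<omega> - m))"
      using assms(2) x(1) by (intro member_le_sum) auto
    with x(2) show ?thesis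
      unfolding Z_def by linarith
  qed
  have Y_int: "integrable M (\<lambda>\<omega>. real (Y \<omega>))"
    using Y_le_Z by (intro Bochner_Integration.integrable_bound[OF Z_int])
      (auto intro!: AE_I2 order_trans[OF _ abs_ge_self])
  have "expectation (\<lambda>\<omega>. real (Y \<omega>)) \<le> expectation Z"
    using Y_le_Z by (intro integral_mono Y_int Z_int)
  also have "\<dots> = m + n / 2 ^ m"
    unfolding Z_def using excess by (simp add: assms(3) prob_space)
  also have "\<dots> \<le> log 2 n + 3"
  proof -
    have "n / 2 ^ m \<le> (1::real)"
      using n_le by (simp add: divide_le_eq)
    with m(2) show ?thesis
      by linarith
  qed
  finally have Y_exp: "expectation (\<lambda>\<omega>. real (Y \<omega>)) \<le> log 2 n + 3" .

  have whp: "1 - 1 / n powr c \<le> prob {\<omega> \<in> space M. Y \<omega> \<le> (c + 1) * log 2 n}" if "c > 0" for c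
  proof -
    define t where "t = (c + 1) * log 2 n"
    \<comment> \<open>The least natural number strictly above \<open>t\<close>, so that
      \<open>k \<le> Y \<omega>\<close> is exactly the failure event. This relies on
      \<open>0 \<le> t\<close>: for negative \<open>t\<close> the conversion by \<open>nat\<close>
      would give 1 instead of 0.\<close>
    define k where "k = nat \<lfloor>t\<rfloor> + 1"
    have "0 \<le> t"
      using that assms(4) by (simp add: t_def)
    have t_less: "t < k"
      unfolding k_def by linarith
    have above_iff: "\<not> real j \<le> t \<longleftrightarrow> k \<le> j" for j
      unfolding k_def using \<open>0 \<le> t\<close> by linarith
    \<comment> \<open>The summand 1 in \<open>c + 1\<close> supplies the factor \<open>n\<close>
      that the union bound over the keys costs.\<close>
    have "real n * n powr c = 2 powr t"
    proof -
      have "2 powr t = (2 powr log 2 n) powr (1 + c)"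
        by (simp add: t_def powr_powr ac_simps)
      then show ?thesis
        using assms(4) by (simp add: powr_add)
    qed
    also have "\<dots> \<le> 2 ^ k"
      using t_less by (simp flip: powr_realpow)
    finally have "n / 2 ^ k \<le> 1 / n powr c"
      using assms(4) by (simp add: field_simps)
    moreover have "prob {\<omega> \<in> space M. Y \<omega> \<le> t} = 1 - prob {\<omega> \<in> space M. k \<le> Y \<omega>}"
      by (subst prob_neg[symmetric]) (auto simp flip: above_iff)
    ultimately show ?thesis
      using tail[of k] by (simp add: t_def)
  qed
  show ?thesis
    using Y_int Y_exp whp unfolding Y_def by blast
qed

end
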